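(* Let $\mathbb{D}$ be a strict double category and let $F:\mathbb{D}\to\mathbb{E}$ be a lax double functor. (i) For every object $x\in\mathbb{D}$, the data $(Fx,F\mathrm{id}_x,F_{x,x},F_x)$, where $F_{x,x}:F\mathrm{id}_x\odot F\mathrm{id}_x\to F\mathrm{id}_x$ is the laxator and $F_x:\mathrm{id}_{Fx}\to F\mathrm{id}_x$ is the unitor, is a category object in $\mathbb{E}$. (ii) For every arrow $f:x\to y$ in $\mathbb{D}$, the arrow $Ff:Fx\to Fy$ together with the cell $F\mathrm{id}_f:F\mathrm{id}_x\to F\mathrm{id}_y$ is a functor in $\mathbb{E}$. (iii) For every cell $\alpha:\mathrm{id}_x\to\mathrm{id}_y$ over $(f,g)$ in $\mathbb{D}$, the cell $F\alpha:F\mathrm{id}_x\to F\mathrm{id}_y$ is a natural transformation in $\mathbb{E}$, from $(Ff,F\mathrm{id}_f)$ to $(Fg,F\mathrm{id}_g)$. Moreover, these assignments are functorial with respect to composition in $\mathbb{D}_0$ and $\mathbb{D}_1$.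
   Context: Double categories are pseudo: strict in the direction of arrows, weak in the direction of proarrows. A double category $\mathbb{D}$ has underlying categories $\mathbb{D}_0$ (objects and arrows) and $\mathbb{D}_1$ (proarrows, written $m: x \nrightarrow y$, and cells). A cell $\alpha: m \to n$ from $m: x \nrightarrow y$ to $n: w \nrightarrow z$ over $(f,g)$ has source arrow $f: x\to w$ and target arrow $g: y \to z$; it is globular if $f,g$ are identities. Composition in $\mathbb{D}_0,\mathbb{D}_1$ is written $\cdot$ in diagrammatic order; external composition is written $\odot$ in diagrammatic order, with external identities $\mathrm{id}_x,\mathrm{id}_f$. Coherence isomorphisms for $\odot$ are suppressed in formulas. Lax double functor $F:\mathbb{D}\to\mathbb{E}$: functors $F_0,F_1$ compatible with source and target, with globular laxators $F_{m,n}:Fm\odot Fn\to F(m\odot n)$ and unitors $F_x:\mathrm{id}_{Fx}\to F\mathrm{id}_x$, natural ($(F\alpha\odot F\beta)\cdot F_{m',n'}=F_{m,n}\cdot F(\alpha\odot\beta)$, $\mathrm{id}_{Ff}\cdot F_y=F_x\cdot F\mathrm{id}_f$), associative and unital; $F_{x,x}=F_{\mathrm{id}_x,\mathrm{id}_x}$. A category object in a double category is $(x,r,\mu,\eta)$ with $r:x\nrightarrow x$ a proarrow and globular cells $\mu:r\odot r\to r$, $\eta:\mathrm{id}_x\to r$ that are associative and unital. A functor $(f,\phi):(x,r,\mu,\eta)\to(y,s,\nu,\theta)$ is an arrow $f:x\to y$ with a cell $\phi:r\to s$ over $(f,f)$ such that $(\phi\odot\phi)\cdot\nu=\mu\cdot\phi$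 and $\mathrm{id}_f\cdot\theta=\eta\cdot\phi$. A natural transformation $(f,\phi)\Rightarrow(g,\psi)$ is a cell $\alpha:\mathrm{id}_x\to s$ over $(f,g)$ with $(\alpha\odot\psi)\cdot\nu=(\phi\odot\alpha)\cdot\nu$; equivalently, a cell $\bar\alpha:r\to s$ over $(f,g)$ with $(\bar\alpha\odot\psi)\cdot\nu=\mu\cdot\bar\alpha=(\phi\odot\bar\alpha)\cdot\nu$ (the correspondence being $\bar\alpha=(\alpha\odot\psi)\cdot\nu$, $\alpha=\eta\cdot\bar\alpha$). In (iii), the cell is a natural transformation in the second, equivalent sense. *)

theory Defs
  imports Main
begin

section \<open>Categories and functors\<close>

text \<open>Composition is written in diagrammatic order and is only meaningful when
  \<open>ccod C a = cdom C b\<close>.\<close>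

record ('o, 'a) cat =
  cobj :: "'o set"
  carr :: "'a set"
  cdom :: "'a \<Rightarrow> 'o"
  ccod :: "'a \<Rightarrow> 'o"
  cident :: "'o \<Rightarrow> 'a"
  ccomp :: "'a \<Rightarrow> 'a \<Rightarrow> 'a"  (infixl "\<cdot>\<index>" 70)

locale category =
  fixes C :: "('o, 'a) cat"
  assumes dom_obj: "a \<in> carr C \<Longrightarrow> cdom C a \<in> cobj C"
    and cod_obj: "a \<in> carr C \<Longrightarrow> ccod C a \<in> cobj C"
    and ident_arr: "x \<in> cobj C \<Longrightarrow> cident C x \<in> carr C"
    and dom_ident: "x \<in> cobj C \<Longrightarrow> cdom C (cident C x) = x"
    and cod_ident: "x \<in> cobj C \<Longrightarrow> ccod C (cident C x) = x"
    and comp_arr: "\<lbrakk>a \<in> carr C; b \<in> carr C; ccod C a = cdom C b\<rbrakk> \<Longrightarrow> a \<cdot>\<^bsub>C\<^esub> b \<in> carr C"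
    and dom_comp: "\<lbrakk>a \<in> carr C; b \<in> carr C; ccod C a = cdom C b\<rbrakk>
          \<Longrightarrow> cdom C (a \<cdot>\<^bsub>C\<^esub> b) = cdom C a"
    and cod_comp: "\<lbrakk>a \<in> carr C; b \<in> carr C; ccod C a = cdom C b\<rbrakk>
          \<Longrightarrow> ccod C (a \<cdot>\<^bsub>C\<^esub> b) = ccod C b"
    and ident_comp: "a \<in> carr C \<Longrightarrow> cident C (cdom C a) \<cdot>\<^bsub>C\<^esub> a = a"
    and comp_ident: "a \<in> carr C \<Longrightarrow> a \<cdot>\<^bsub>C\<^esub> cident C (ccod C a) = a"
    and comp_assoc: "\<lbrakk>a \<in> carr C; b \<in> carr C; c \<in> carr C; ccod C a = cdom C b; ccod C b = cdom C c\<rbrakk>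
          \<Longrightarrow> (a \<cdot>\<^bsub>C\<^esub> b) \<cdot>\<^bsub>C\<^esub> c = a \<cdot>\<^bsub>C\<^esub> (b \<cdot>\<^bsub>C\<^esub> c)"

definition iso_arr :: "('o, 'a) cat \<Rightarrow> 'a \<Rightarrow> bool" where
  "iso_arr C a \<longleftrightarrow> a \<in> carr C \<and>
     (\<exists>b \<in> carr C. cdom C b = ccod C a \<and> ccod C b = cdom C a \<and>
        a \<cdot>\<^bsub>C\<^esub> b = cident C (cdom C a) \<and> b \<cdot>\<^bsub>C\<^esub> a = cident C (ccod C a))"

definition full_subcat :: "('o, 'a) cat \<Rightarrow> 'o set \<Rightarrow> ('o, 'a) cat" where
  "full_subcat C S =
     C\<lparr>cobj := cobj C \<inter> S, carr := {a \<in> carr C. cdom C a \<in> S \<and> ccod C a \<in> S}\<rparr>"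

locale cat_functor = A: category A + B: category B
  for A :: "('o, 'a) cat" and B :: "('o2, 'a2) cat" +
  fixes Fo :: "'o \<Rightarrow> 'o2" and Fa :: "'a \<Rightarrow> 'a2"
  assumes map_obj: "x \<in> cobj A \<Longrightarrow> Fo x \<in> cobj B"
    and map_arr: "a \<in> carr A \<Longrightarrow> Fa a \<in> carr B"
    and map_dom: "a \<in> carr A \<Longrightarrow> cdom B (Fa a) = Fo (cdom A a)"
    and map_cod: "a \<in> carr A \<Longrightarrow> ccod B (Fa a) = Fo (ccod A a)"
    and map_ident: "x \<in> cobj A \<Longrightarrow> Fa (cident A x) = cident B (Fo x)"
    and map_comp: "\<lbrakk>a \<in> carr A; b \<in> carr A; ccod A a = cdom A b\<rbrakk>
          \<Longrightarrow> Fa (a \<cdot>\<^bsub>A\<^esub> b) = Fa a \<cdot>\<^bsub>B\<^esub> Fa b"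


section \<open>Pseudo double categories\<close>

text \<open>\<open>D0\<close> has the objects and arrows, \<open>D1\<close> the proarrows (as objects) and the cells (as
  arrows).  \<open>psrc\<close>, \<open>ptgt\<close> and \<open>csrc\<close>, \<open>ctgt\<close> are the external source and target of proarrows
  and of cells; \<open>pid\<close> and \<open>cid\<close> are the external identities of objects and of arrows (the identity
  cell of a proarrow \<open>m\<close> is \<open>cident (D1 D) m\<close>).  External composition is in diagrammatic order.
  \<open>lassoc m n p\<close> goes from \<open>(m \<odot> n) \<odot> p\<close> to \<open>m \<odot> (n \<odot> p)\<close>.\<close>

record ('o, 'a, 'p, 'c) double_cat =
  D0 :: "('o, 'a) cat"
  D1 :: "('p, 'c) cat"
  psrc :: "'p \<Rightarrow> 'o"
  ptgt :: "'p \<Rightarrow> 'o"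
  csrc :: "'c \<Rightarrow> 'a"
  ctgt :: "'c \<Rightarrow> 'a"
  pid :: "'o \<Rightarrow> 'p"
  cid :: "'a \<Rightarrow> 'c"
  pext :: "'p \<Rightarrow> 'p \<Rightarrow> 'p"  (infixl "\<odot>\<^sub>p\<index>" 75)
  cext :: "'c \<Rightarrow> 'c \<Rightarrow> 'c"  (infixl "\<odot>\<index>" 75)
  lassoc :: "'p \<Rightarrow> 'p \<Rightarrow> 'p \<Rightarrow> 'c"
  lunit :: "'p \<Rightarrow> 'c"
  runit :: "'p \<Rightarrow> 'c"

definition is_cell ::
  "('o, 'a, 'p, 'c) double_cat \<Rightarrow> 'c \<Rightarrow> 'p \<Rightarrow> 'p \<Rightarrow> 'a \<Rightarrow> 'a \<Rightarrow> bool" where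
  "is_cell D \<alpha> m n f g \<longleftrightarrow> \<alpha> \<in> carr (D1 D) \<and> cdom (D1 D) \<alpha> = m \<and> ccod (D1 D) \<alpha> = n
     \<and> csrc D \<alpha> = f \<and> ctgt D \<alpha> = g"

definition globular :: "('o, 'a, 'p, 'c) double_cat \<Rightarrow> 'c \<Rightarrow> 'p \<Rightarrow> 'p \<Rightarrow> bool" where
  "globular D \<alpha> m n \<longleftrightarrow>
     is_cell D \<alpha> m n (cident (D0 D) (psrc D m)) (cident (D0 D) (ptgt D m))"

text \<open>The pullback of \<open>D1\<close> with itself over \<open>D0\<close>, the domain of external composition.\<close>

definition composable_pairs ::
  "('o, 'a, 'p, 'c) double_cat \<Rightarrow> ('p \<times> 'p, 'c \<times> 'c) cat" where
  "composable_pairs D = \<lparr>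
     cobj = {(m, n). m \<in> cobj (D1 D) \<and> n \<in> cobj (D1 D) \<and> ptgt D m = psrc D n},
     carr = {(\<alpha>, \<beta>). \<alpha> \<in> carr (D1 D) \<and> \<beta> \<in> carr (D1 D) \<and> ctgt D \<alpha> = csrc D \<beta>},
     cdom = (\<lambda>(\<alpha>, \<beta>). (cdom (D1 D) \<alpha>, cdom (D1 D) \<beta>)),
     ccod = (\<lambda>(\<alpha>, \<beta>). (ccod (D1 D) \<alpha>, ccod (D1 D) \<beta>)),
     cident = (\<lambda>(m, n). (cident (D1 D) m, cident (D1 D) n)),
     ccomp = (\<lambda>(\<alpha>, \<beta>) (\<alpha>', \<beta>'). (\<alpha> \<cdot>\<^bsub>D1 D\<^esub> \<alpha>', \<beta> \<cdot>\<^bsub>D1 D\<^esub> \<beta>'))\<rparr>"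

locale double_category =
  fixes D :: "('o, 'a, 'p, 'c) double_cat"
  assumes cat0: "category (D0 D)"
    and cat1: "category (D1 D)"
    and src_functor: "cat_functor (D1 D) (D0 D) (psrc D) (csrc D)"
    and tgt_functor: "cat_functor (D1 D) (D0 D) (ptgt D) (ctgt D)"
    and id_functor: "cat_functor (D0 D) (D1 D) (pid D) (cid D)"
    and ext_functor: "cat_functor (composable_pairs D) (D1 D)
          (\<lambda>(m, n). m \<odot>\<^sub>p\<^bsub>D\<^esub> n) (\<lambda>(\<alpha>, \<beta>). \<alpha> \<odot>\<^bsub>D\<^esub> \<beta>)"
    and psrc_pid: "x \<in> cobj (D0 D) \<Longrightarrow> psrc D (pid D x) = x"
    and ptgt_pid: "x \<in> cobj (D0 D) \<Longrightarrow> ptgt D (pid D x) = x"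
    and csrc_cid: "f \<in> carr (D0 D) \<Longrightarrow> csrc D (cid D f) = f"
    and ctgt_cid: "f \<in> carr (D0 D) \<Longrightarrow> ctgt D (cid D f) = f"
    and psrc_ext: "(m, n) \<in> cobj (composable_pairs D) \<Longrightarrow> psrc D (m \<odot>\<^sub>p\<^bsub>D\<^esub> n) = psrc D m"
    and ptgt_ext: "(m, n) \<in> cobj (composable_pairs D) \<Longrightarrow> ptgt D (m \<odot>\<^sub>p\<^bsub>D\<^esub> n) = ptgt D n"
    and csrc_ext: "(\<alpha>, \<beta>) \<in> carr (composable_pairs D) \<Longrightarrow> csrc D (\<alpha> \<odot>\<^bsub>D\<^esub> \<beta>) = csrc D \<alpha>"
    and ctgt_ext: "(\<alpha>, \<beta>) \<in> carr (composable_pairs D) \<Longrightarrow> ctgt D (\<alpha> \<odot>\<^bsub>D\<^esub> \<beta>) = ctgt D \<beta>"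
    and assoc_cell: "\<lbrakk>(m, n) \<in> cobj (composable_pairs D); (n, p) \<in> cobj (composable_pairs D)\<rbrakk>
          \<Longrightarrow> globular D (lassoc D m n p)
                ((m \<odot>\<^sub>p\<^bsub>D\<^esub> n) \<odot>\<^sub>p\<^bsub>D\<^esub> p) (m \<odot>\<^sub>p\<^bsub>D\<^esub> (n \<odot>\<^sub>p\<^bsub>D\<^esub> p))"
    and assoc_iso: "\<lbrakk>(m, n) \<in> cobj (composable_pairs D); (n, p) \<in> cobj (composable_pairs D)\<rbrakk>
          \<Longrightarrow> iso_arr (D1 D) (lassoc D m n p)"
    and assoc_natural:
      "\<lbrakk>(\<alpha>, \<beta>) \<in> carr (composable_pairs D); (\<beta>, \<gamma>) \<in> carr (composable_pairs D)\<rbrakk>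
          \<Longrightarrow> ((\<alpha> \<odot>\<^bsub>D\<^esub> \<beta>) \<odot>\<^bsub>D\<^esub> \<gamma>)
                \<cdot>\<^bsub>D1 D\<^esub> lassoc D (ccod (D1 D) \<alpha>) (ccod (D1 D) \<beta>) (ccod (D1 D) \<gamma>)
              = lassoc D (cdom (D1 D) \<alpha>) (cdom (D1 D) \<beta>) (cdom (D1 D) \<gamma>)
                \<cdot>\<^bsub>D1 D\<^esub> (\<alpha> \<odot>\<^bsub>D\<^esub> (\<beta> \<odot>\<^bsub>D\<^esub> \<gamma>))"
    and lunit_cell: "m \<in> cobj (D1 D) \<Longrightarrow> globular D (lunit D m) (pid D (psrc D m) \<odot>\<^sub>p\<^bsub>D\<^esub> m) m"
    and lunit_iso: "m \<in> cobj (D1 D) \<Longrightarrow> iso_arr (D1 D) (lunit D m)"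
    and lunit_natural: "\<alpha> \<in> carr (D1 D)
          \<Longrightarrow> (cid D (csrc D \<alpha>) \<odot>\<^bsub>D\<^esub> \<alpha>) \<cdot>\<^bsub>D1 D\<^esub> lunit D (ccod (D1 D) \<alpha>)
              = lunit D (cdom (D1 D) \<alpha>) \<cdot>\<^bsub>D1 D\<^esub> \<alpha>"
    and runit_cell: "m \<in> cobj (D1 D) \<Longrightarrow> globular D (runit D m) (m \<odot>\<^sub>p\<^bsub>D\<^esub> pid D (ptgt D m)) m"
    and runit_iso: "m \<in> cobj (D1 D) \<Longrightarrow> iso_arr (D1 D) (runit D m)"
    and runit_natural: "\<alpha> \<in> carr (D1 D)
          \<Longrightarrow> (\<alpha> \<odot>\<^bsub>D\<^esub> cid D (ctgt D \<alpha>)) \<cdot>\<^bsub>D1 D\<^esub> runit D (ccod (D1 D) \<alpha>)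
              = runit D (cdom (D1 D) \<alpha>) \<cdot>\<^bsub>D1 D\<^esub> \<alpha>"
    and pentagon: "\<lbrakk>(m, n) \<in> cobj (composable_pairs D); (n, p) \<in> cobj (composable_pairs D);
          (p, q) \<in> cobj (composable_pairs D)\<rbrakk>
          \<Longrightarrow> (lassoc D m n p \<odot>\<^bsub>D\<^esub> cident (D1 D) q) \<cdot>\<^bsub>D1 D\<^esub> lassoc D m (n \<odot>\<^sub>p\<^bsub>D\<^esub> p) q
                \<cdot>\<^bsub>D1 D\<^esub> (cident (D1 D) m \<odot>\<^bsub>D\<^esub> lassoc D n p q)
              = lassoc D (m \<odot>\<^sub>p\<^bsub>D\<^esub> n) p q \<cdot>\<^bsub>D1 D\<^esub> lassoc D m n (p \<odot>\<^sub>p\<^bsub>D\<^esub> q)"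
    and triangle: "(m, n) \<in> cobj (composable_pairs D)
          \<Longrightarrow> lassoc D m (pid D (ptgt D m)) n \<cdot>\<^bsub>D1 D\<^esub> (cident (D1 D) m \<odot>\<^bsub>D\<^esub> lunit D n)
              = runit D m \<odot>\<^bsub>D\<^esub> cident (D1 D) n"

locale strict_double_category = double_category +
  assumes strict_assoc:
      "\<lbrakk>(m, n) \<in> cobj (composable_pairs D); (n, p) \<in> cobj (composable_pairs D)\<rbrakk>
          \<Longrightarrow> (m \<odot>\<^sub>p\<^bsub>D\<^esub> n) \<odot>\<^sub>p\<^bsub>D\<^esub> p = m \<odot>\<^sub>p\<^bsub>D\<^esub> (n \<odot>\<^sub>p\<^bsub>D\<^esub> p)
            \<and> lassoc D m n p = cident (D1 D) (m \<odot>\<^sub>p\<^bsub>D\<^esub> (n \<odot>\<^sub>p\<^bsub>D\<^esub> p))"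
    and strict_lunit: "m \<in> cobj (D1 D)
          \<Longrightarrow> pid D (psrc D m) \<odot>\<^sub>p\<^bsub>D\<^esub> m = m \<and> lunit D m = cident (D1 D) m"
    and strict_runit: "m \<in> cobj (D1 D)
          \<Longrightarrow> m \<odot>\<^sub>p\<^bsub>D\<^esub> pid D (ptgt D m) = m \<and> runit D m = cident (D1 D) m"


section \<open>Lax double functors\<close>

text \<open>\<open>laxator F m n\<close> is \<open>F\<^sub>m\<^sub>,\<^sub>n : F m \<odot> F n \<rightarrow> F (m \<odot> n)\<close> and \<open>unitor F x\<close> is
  \<open>F\<^sub>x : id (F x) \<rightarrow> F (id x)\<close>.\<close>

record ('o, 'a, 'p, 'c, 'o2, 'a2, 'p2, 'c2) lax_fun =
  Fobj :: "'o \<Rightarrow> 'o2"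
  Farr :: "'a \<Rightarrow> 'a2"
  Fpro :: "'p \<Rightarrow> 'p2"
  Fcell :: "'c \<Rightarrow> 'c2"
  laxator :: "'p \<Rightarrow> 'p \<Rightarrow> 'c2"
  unitor :: "'o \<Rightarrow> 'c2"

locale lax_double_functor = D: double_category D + E: double_category E
  for D :: "('o, 'a, 'p, 'c) double_cat" and E :: "('o2, 'a2, 'p2, 'c2) double_cat" +
  fixes F :: "('o, 'a, 'p, 'c, 'o2, 'a2, 'p2, 'c2) lax_fun"
  assumes functor0: "cat_functor (D0 D) (D0 E) (Fobj F) (Farr F)"
    and functor1: "cat_functor (D1 D) (D1 E) (Fpro F) (Fcell F)"
    and F_psrc: "m \<in> cobj (D1 D) \<Longrightarrow> psrc E (Fpro F m) = Fobj F (psrc D m)"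
    and F_ptgt: "m \<in> cobj (D1 D) \<Longrightarrow> ptgt E (Fpro F m) = Fobj F (ptgt D m)"
    and F_csrc: "\<alpha> \<in> carr (D1 D) \<Longrightarrow> csrc E (Fcell F \<alpha>) = Farr F (csrc D \<alpha>)"
    and F_ctgt: "\<alpha> \<in> carr (D1 D) \<Longrightarrow> ctgt E (Fcell F \<alpha>) = Farr F (ctgt D \<alpha>)"
    and laxator_cell: "(m, n) \<in> cobj (composable_pairs D)
          \<Longrightarrow> globular E (laxator F m n) (Fpro F m \<odot>\<^sub>p\<^bsub>E\<^esub> Fpro F n) (Fpro F (m \<odot>\<^sub>p\<^bsub>D\<^esub> n))"
    and unitor_cell: "x \<in> cobj (D0 D)
          \<Longrightarrow> globular E (unitor F x) (pid E (Fobj F x)) (Fpro F (pid D x))"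
    and laxator_natural: "(\<alpha>, \<beta>) \<in> carr (composable_pairs D)
          \<Longrightarrow> (Fcell F \<alpha> \<odot>\<^bsub>E\<^esub> Fcell F \<beta>)
                \<cdot>\<^bsub>D1 E\<^esub> laxator F (ccod (D1 D) \<alpha>) (ccod (D1 D) \<beta>)
              = laxator F (cdom (D1 D) \<alpha>) (cdom (D1 D) \<beta>) \<cdot>\<^bsub>D1 E\<^esub> Fcell F (\<alpha> \<odot>\<^bsub>D\<^esub> \<beta>)"
    and unitor_natural: "f \<in> carr (D0 D)
          \<Longrightarrow> cid E (Farr F f) \<cdot>\<^bsub>D1 E\<^esub> unitor F (ccod (D0 D) f)
              = unitor F (cdom (D0 D) f) \<cdot>\<^bsub>D1 E\<^esub> Fcell F (cid D f)"
    and laxator_assoc: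
      "\<lbrakk>(m, n) \<in> cobj (composable_pairs D); (n, p) \<in> cobj (composable_pairs D)\<rbrakk>
          \<Longrightarrow> (laxator F m n \<odot>\<^bsub>E\<^esub> cident (D1 E) (Fpro F p))
                \<cdot>\<^bsub>D1 E\<^esub> laxator F (m \<odot>\<^sub>p\<^bsub>D\<^esub> n) p \<cdot>\<^bsub>D1 E\<^esub> Fcell F (lassoc D m n p)
              = lassoc E (Fpro F m) (Fpro F n) (Fpro F p)
                \<cdot>\<^bsub>D1 E\<^esub> (cident (D1 E) (Fpro F m) \<odot>\<^bsub>E\<^esub> laxator F n p)
                \<cdot>\<^bsub>D1 E\<^esub> laxator F m (n \<odot>\<^sub>p\<^bsub>D\<^esub> p)"
    and unitor_left: "m \<in> cobj (D1 D)
          \<Longrightarrow> (unitor F (psrc D m) \<odot>\<^bsub>E\<^esub> cident (D1 E) (Fpro F m))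
                \<cdot>\<^bsub>D1 E\<^esub> laxator F (pid D (psrc D m)) m \<cdot>\<^bsub>D1 E\<^esub> Fcell F (lunit D m)
              = lunit E (Fpro F m)"
    and unitor_right: "m \<in> cobj (D1 D)
          \<Longrightarrow> (cident (D1 E) (Fpro F m) \<odot>\<^bsub>E\<^esub> unitor F (ptgt D m))
                \<cdot>\<^bsub>D1 E\<^esub> laxator F m (pid D (ptgt D m)) \<cdot>\<^bsub>D1 E\<^esub> Fcell F (runit D m)
              = runit E (Fpro F m)"


section \<open>Category objects, their functors and natural transformations\<close>

type_synonym ('o, 'p, 'c) catob = "'o \<times> 'p \<times> 'c \<times> 'c"

fun category_object ::
  "('o, 'a, 'p, 'c) double_cat \<Rightarrow> ('o, 'p, 'c) catob \<Rightarrow> bool" where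
  "category_object E (x, r, \<mu>, \<eta>) \<longleftrightarrow>
     x \<in> cobj (D0 E) \<and> r \<in> cobj (D1 E) \<and> psrc E r = x \<and> ptgt E r = x \<and>
     globular E \<mu> (r \<odot>\<^sub>p\<^bsub>E\<^esub> r) r \<and>
     globular E \<eta> (pid E x) r \<and>
     (\<mu> \<odot>\<^bsub>E\<^esub> cident (D1 E) r) \<cdot>\<^bsub>D1 E\<^esub> \<mu>
       = lassoc E r r r \<cdot>\<^bsub>D1 E\<^esub> (cident (D1 E) r \<odot>\<^bsub>E\<^esub> \<mu>) \<cdot>\<^bsub>D1 E\<^esub> \<mu> \<and>
     (\<eta> \<odot>\<^bsub>E\<^esub> cident (D1 E) r) \<cdot>\<^bsub>D1 E\<^esub> \<mu> = lunit E r \<and>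
     (cident (D1 E) r \<odot>\<^bsub>E\<^esub> \<eta>) \<cdot>\<^bsub>D1 E\<^esub> \<mu> = runit E r"

fun internal_functor ::
  "('o, 'a, 'p, 'c) double_cat \<Rightarrow> ('o, 'p, 'c) catob \<Rightarrow> ('o, 'p, 'c) catob \<Rightarrow> 'a \<times> 'c \<Rightarrow> bool" where
  "internal_functor E (x, r, \<mu>, \<eta>) (y, s, \<nu>, \<theta>) (f, \<phi>) \<longleftrightarrow>
     category_object E (x, r, \<mu>, \<eta>) \<and> category_object E (y, s, \<nu>, \<theta>) \<and>
     f \<in> carr (D0 E) \<and> cdom (D0 E) f = x \<and> ccod (D0 E) f = y \<and>
     is_cell E \<phi> r s f f \<and>
     (\<phi> \<odot>\<^bsub>E\<^esub> \<phi>) \<cdot>\<^bsub>D1 E\<^esub> \<nu> = \<mu> \<cdot>\<^bsub>D1 E\<^esub> \<phi> \<and>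
     cid E f \<cdot>\<^bsub>D1 E\<^esub> \<theta> = \<eta> \<cdot>\<^bsub>D1 E\<^esub> \<phi>"

text \<open>A natural transformation is given here by its total cell \<open>r \<rightarrow> s\<close> over \<open>(f, g)\<close>,
  rather than by its component cell \<open>id x \<rightarrow> s\<close>.\<close>

fun internal_transf ::
  "('o, 'a, 'p, 'c) double_cat \<Rightarrow> ('o, 'p, 'c) catob \<Rightarrow> ('o, 'p, 'c) catob
     \<Rightarrow> 'a \<times> 'c \<Rightarrow> 'a \<times> 'c \<Rightarrow> 'c \<Rightarrow> bool" where
  "internal_transf E (x, r, \<mu>, \<eta>) (y, s, \<nu>, \<theta>) (f, \<phi>) (g, \<psi>) \<alpha> \<longleftrightarrow>
     internal_functor E (x, r, \<mu>, \<eta>) (y, s, \<nu>, \<theta>) (f, \<phi>) \<and>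
     internal_functor E (x, r, \<mu>, \<eta>) (y, s, \<nu>, \<theta>) (g, \<psi>) \<and>
     is_cell E \<alpha> r s f g \<and>
     (\<alpha> \<odot>\<^bsub>E\<^esub> \<psi>) \<cdot>\<^bsub>D1 E\<^esub> \<nu> = \<mu> \<cdot>\<^bsub>D1 E\<^esub> \<alpha> \<and>
     \<mu> \<cdot>\<^bsub>D1 E\<^esub> \<alpha> = (\<phi> \<odot>\<^bsub>E\<^esub> \<alpha>) \<cdot>\<^bsub>D1 E\<^esub> \<nu>"

fun ident_functor :: "('o, 'a, 'p, 'c) double_cat \<Rightarrow> ('o, 'p, 'c) catob \<Rightarrow> 'a \<times> 'c" where
  "ident_functor E (x, r, \<mu>, \<eta>) = (cident (D0 E) x, cident (D1 E) r)"

fun comp_functor :: "('o, 'a, 'p, 'c) double_cat \<Rightarrow> 'a \<times> 'c \<Rightarrow> 'a \<times> 'c \<Rightarrow> 'a \<times> 'c" where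
  "comp_functor E (f, \<phi>) (g, \<psi>) = (f \<cdot>\<^bsub>D0 E\<^esub> g, \<phi> \<cdot>\<^bsub>D1 E\<^esub> \<psi>)"

text \<open>Category objects and functors in \<open>E\<close>; an arrow \<open>(X, Y, P)\<close> is a functor \<open>P\<close> from \<open>X\<close> to
  \<open>Y\<close>.\<close>

definition functor_cat ::
  "('o, 'a, 'p, 'c) double_cat \<Rightarrow>
     (('o, 'p, 'c) catob, ('o, 'p, 'c) catob \<times> ('o, 'p, 'c) catob \<times> ('a \<times> 'c)) cat" where
  "functor_cat E = \<lparr>
     cobj = {X. category_object E X},
     carr = {(X, Y, P). internal_functor E X Y P},
     cdom = (\<lambda>(X, Y, P). X),
     ccod = (\<lambda>(X, Y, P). Y),
     cident = (\<lambda>X. (X, X, ident_functor E X)),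
     ccomp = (\<lambda>(X, Y, P) (Y', Z, Q). (X, Z, comp_functor E P Q))\<rparr>"

text \<open>Category objects and natural transformations in \<open>E\<close>; an arrow \<open>(X, Y, P, Q, \<alpha>)\<close> is a
  natural transformation from \<open>P\<close> to \<open>Q\<close>, which are functors from \<open>X\<close> to \<open>Y\<close>.  Composition is that
  of total cells in \<open>D1 E\<close>; in terms of the two-dimensional structure it is the horizontal composition
  of natural transformations.\<close>

definition transf_cat ::
  "('o, 'a, 'p, 'c) double_cat \<Rightarrow>
     (('o, 'p, 'c) catob,
      ('o, 'p, 'c) catob \<times> ('o, 'p, 'c) catob \<times> ('a \<times> 'c) \<times> ('a \<times> 'c) \<times> 'c) cat" where
  "transf_cat E = \<lparr>
     cobj = {X. category_object E X},
     carr = {(X, Y, P, Q, \<alpha>). internal_transf E X Y P Q \<alpha>},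
     cdom = (\<lambda>(X, Y, P, Q, \<alpha>). X),
     ccod = (\<lambda>(X, Y, P, Q, \<alpha>). Y),
     cident = (\<lambda>X. (X, X, ident_functor E X, ident_functor E X,
                    cident (D1 E) (fst (snd X)))),
     ccomp = (\<lambda>(X, Y, P, Q, \<alpha>) (Y', Z, P', Q', \<beta>).
                (X, Z, comp_functor E P P', comp_functor E Q Q', \<alpha> \<cdot>\<^bsub>D1 E\<^esub> \<beta>))\<rparr>"


section \<open>The assignments induced by a lax double functor\<close>

definition image_catob ::
  "('o, 'a, 'p, 'c) double_cat \<Rightarrow> ('o, 'a, 'p, 'c, 'o2, 'a2, 'p2, 'c2) lax_fun
     \<Rightarrow> 'o \<Rightarrow> ('o2, 'p2, 'c2) catob" where
  "image_catob D F x =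
     (Fobj F x, Fpro F (pid D x), laxator F (pid D x) (pid D x), unitor F x)"

definition image_functor ::
  "('o, 'a, 'p, 'c) double_cat \<Rightarrow> ('o, 'a, 'p, 'c, 'o2, 'a2, 'p2, 'c2) lax_fun
     \<Rightarrow> 'a \<Rightarrow> 'a2 \<times> 'c2" where
  "image_functor D F f = (Farr F f, Fcell F (cid D f))"

end

theory Submission
  imports Defs
begin

text \<open>Strictness of the domain makes \<open>id\<^sub>x \<odot> id\<^sub>x = id\<^sub>x\<close> and
  \<open>\<alpha> \<odot> id\<^sub>g = \<alpha> = id\<^sub>f \<odot> \<alpha>\<close> hold on the nose.  The category object axioms
  for \<open>F id\<^sub>x\<close> are then the coherence axioms of \<open>F\<close> at identity proarrows, and the axioms for
  functors and natural transformations are naturality of the laxators and unitors.\<close>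

section \<open>Endpoints of internal functors and transformations; full subcategories\<close>

lemma internal_functor_cod: "internal_functor E X Y P \<Longrightarrow> category_object E Y"
  and internal_functor_dom: "internal_functor E X Y P \<Longrightarrow> category_object E X"
  by (cases X; cases Y; cases P; auto)+

text \<open>The boundary is read off with \<open>fst\<close> and \<open>snd\<close>, so that these
  rules apply to tuples that have not been split.\<close>

lemma internal_transf_src: "internal_transf E X Y P Q \<alpha> \<Longrightarrow> internal_functor E X Y P"
  and internal_transf_tgt: "internal_transf E X Y P Q \<alpha> \<Longrightarrow> internal_functor E X Y Q"
  and internal_transf_cell: "internal_transf E X Y P Q \<alpha>
    \<Longrightarrow> is_cell E \<alpha> (fst (snd X)) (fst (snd Y)) (fst P) (fst Q)"
  by (cases X; cases Y; cases P; cases Q; auto)+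

lemma category_full_subcat:
  assumes "category C"
  shows "category (full_subcat C S)"
proof -
  interpret category C by fact
  show ?thesis
    by unfold_locales
      (auto simp: full_subcat_def dom_obj cod_obj ident_arr dom_ident cod_ident comp_arr
        dom_comp cod_comp ident_comp comp_ident comp_assoc)
qed

section \<open>Calculus of framed cells in a pseudo double category\<close>

context double_category
begin

sublocale C0: category "D0 D" by (rule cat0)
sublocale C1: category "D1 D" by (rule cat1)
sublocale src: cat_functor "D1 D" "D0 D" "psrc D" "csrc D" by (rule src_functor)
sublocale tgt: cat_functor "D1 D" "D0 D" "ptgt D" "ctgt D" by (rule tgt_functor)
sublocale idf: cat_functor "D0 D" "D1 D" "pid D" "cid D" by (rule id_functor)
sublocale ext: cat_functor "composable_pairs D" "D1 D"
  "\<lambda>(m, n). m \<odot>\<^sub>p\<^bsub>D\<^esub> n" "\<lambda>(\<alpha>, \<beta>). \<alpha> \<odot>\<^bsub>D\<^esub> \<beta>"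
  by (rule ext_functor)

lemma cell_obj:
  assumes "is_cell D \<alpha> m n f g"
  shows "m \<in> cobj (D1 D)" "n \<in> cobj (D1 D)"
  using assms C1.dom_obj C1.cod_obj by (auto simp: is_cell_def)

text \<open>Carrying the whole boundary in \<open>is_cell\<close> settles composability by matching.
  The frame arrows compose because external source and target are functors.\<close>

lemma cell_comp:
  assumes "is_cell D \<alpha> m n f g" "is_cell D \<beta> n p f' g'"
  shows "is_cell D (\<alpha> \<cdot>\<^bsub>D1 D\<^esub> \<beta>) m p (f \<cdot>\<^bsub>D0 D\<^esub> f') (g \<cdot>\<^bsub>D0 D\<^esub> g')"
  using assms
  by (auto simp: is_cell_def C1.comp_arr C1.dom_comp C1.cod_comp src.map_comp tgt.map_comp)

lemma cell_assoc:
  assumes "is_cell D \<alpha> m n f g" "is_cell D \<beta> n p f' g'" "is_cell D \<gamma> p q f'' g''"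
  shows "\<alpha> \<cdot>\<^bsub>D1 D\<^esub> \<beta> \<cdot>\<^bsub>D1 D\<^esub> \<gamma> = \<alpha> \<cdot>\<^bsub>D1 D\<^esub> (\<beta> \<cdot>\<^bsub>D1 D\<^esub> \<gamma>)"
  using assms by (auto simp: is_cell_def C1.comp_assoc)

lemma cell_ext:
  assumes "is_cell D \<alpha> m n f g" "is_cell D \<beta> m' n' g h"
  shows "is_cell D (\<alpha> \<odot>\<^bsub>D\<^esub> \<beta>) (m \<odot>\<^sub>p\<^bsub>D\<^esub> m') (n \<odot>\<^sub>p\<^bsub>D\<^esub> n') f h"
proof -
  have "(\<alpha>, \<beta>) \<in> carr (composable_pairs D)"
    using assms by (auto simp: is_cell_def composable_pairs_def)
  from ext.map_arr[OF this] ext.map_dom[OF this] ext.map_cod[OF this]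
    csrc_ext[OF this] ctgt_ext[OF this]
  show ?thesis using assms by (auto simp: is_cell_def composable_pairs_def)
qed

text \<open>This is preservation of composition by the functor \<open>ext\<close>; the shared arrows
  \<open>g\<close> and \<open>g'\<close> place both pairs in the pullback
  \<open>composable_pairs D\<close>.\<close>

lemma interchange:
  assumes "is_cell D \<alpha> m n f g" "is_cell D \<alpha>' n p f' g'"
    and "is_cell D \<beta> k l g h" "is_cell D \<beta>' l q g' h'"
  shows "(\<alpha> \<cdot>\<^bsub>D1 D\<^esub> \<alpha>') \<odot>\<^bsub>D\<^esub> (\<beta> \<cdot>\<^bsub>D1 D\<^esub> \<beta>')
    = (\<alpha> \<odot>\<^bsub>D\<^esub> \<beta>) \<cdot>\<^bsub>D1 D\<^esub> (\<alpha>' \<odot>\<^bsub>D\<^esub> \<beta>')"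
  using ext.map_comp[of "(\<alpha>, \<beta>)" "(\<alpha>', \<beta>')"] assms
  by (auto simp: is_cell_def composable_pairs_def)

lemma ext_ident:
  assumes "m \<in> cobj (D1 D)" "n \<in> cobj (D1 D)" "ptgt D m = psrc D n"
  shows "cident (D1 D) m \<odot>\<^bsub>D\<^esub> cident (D1 D) n = cident (D1 D) (m \<odot>\<^sub>p\<^bsub>D\<^esub> n)"
  using ext.map_ident[of "(m, n)"] assms by (auto simp: composable_pairs_def)

lemma ident_cell:
  assumes "m \<in> cobj (D1 D)"
  shows "is_cell D (cident (D1 D) m) m m
    (cident (D0 D) (psrc D m)) (cident (D0 D) (ptgt D m))"
  using assms
  by (auto simp: is_cell_def C1.ident_arr C1.dom_ident C1.cod_ident src.map_ident tgt.map_ident)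

lemma cid_cell:
  assumes "f \<in> carr (D0 D)"
  shows "is_cell D (cid D f) (pid D (cdom (D0 D) f)) (pid D (ccod (D0 D) f)) f f"
  using assms by (auto simp: is_cell_def idf.map_arr idf.map_dom idf.map_cod csrc_cid ctgt_cid)

lemma cell_ident_comp: "is_cell D \<alpha> m n f g \<Longrightarrow> cident (D1 D) m \<cdot>\<^bsub>D1 D\<^esub> \<alpha> = \<alpha>"
  and cell_comp_ident: "is_cell D \<alpha> m n f g \<Longrightarrow> \<alpha> \<cdot>\<^bsub>D1 D\<^esub> cident (D1 D) n = \<alpha>"
  using C1.ident_comp C1.comp_ident by (auto simp: is_cell_def)

text \<open>Compatibility with \<mu> reduces to \<open>ext_ident\<close>, and compatibility with
  \<eta> to the fact that the external identity of an identity arrow is an identity cell.\<close>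

lemma internal_functor_ident:
  assumes "category_object D X"
  shows "internal_functor D X X (ident_functor D X)"
proof (cases X)
  case (fields x r \<mu> \<eta>)
  have r: "r \<in> cobj (D1 D)" "psrc D r = x" "ptgt D r = x" and x: "x \<in> cobj (D0 D)"
    and \<mu>: "globular D \<mu> (r \<odot>\<^sub>p\<^bsub>D\<^esub> r) r" and \<eta>: "globular D \<eta> (pid D x) r"
    using assms fields by auto
  show ?thesis
    using assms fields r x ident_cell[OF r(1)] ext_ident[OF r(1) r(1)]
      cell_ident_comp[OF \<mu>[unfolded globular_def]] cell_comp_ident[OF \<mu>[unfolded globular_def]]
      cell_ident_comp[OF \<eta>[unfolded globular_def]] cell_comp_ident[OF \<eta>[unfolded globular_def]]
    by (simp add: C0.ident_arr C0.dom_ident C0.cod_ident idf.map_ident)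
qed

text \<open>Two compatibility squares are pasted. For multiplication, interchange first splits the
  external square of \<phi> \<cdot> \<psi> into those of \<phi> and \<psi>; then the structure cell
  slides past \<psi> and past \<phi>.\<close>

lemma internal_functor_comp:
  assumes "internal_functor D X Y P" "internal_functor D Y Z Q"
  shows "internal_functor D X Z (comp_functor D P Q)"
proof -
  obtain x r \<mu> \<eta> where X: "X = (x, r, \<mu>, \<eta>)" by (cases X)
  obtain y s \<nu> \<theta> where Y: "Y = (y, s, \<nu>, \<theta>)" by (cases Y)
  obtain z t \<pi> \<zeta> where Z: "Z = (z, t, \<pi>, \<zeta>)" by (cases Z)
  obtain f \<phi> where P: "P = (f, \<phi>)" by (cases P)
  obtain g \<psi> where Q: "Q = (g, \<psi>)" by (cases Q)
  have f: "f \<in> carr (D0 D)" "cdom (D0 D) f = x" "ccod (D0 D) f = y"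
    and g: "g \<in> carr (D0 D)" "cdom (D0 D) g = y" "ccod (D0 D) g = z"
    and \<phi>: "is_cell D \<phi> r s f f" and \<psi>: "is_cell D \<psi> s t g g"
    \<comment> \<open>The frames keep the form that \<open>globular\<close> gives them:
      \<open>cell_assoc\<close> only matches the boundary proarrows.\<close>
    and \<mu>: "is_cell D \<mu> (r \<odot>\<^sub>p\<^bsub>D\<^esub> r) r (cident (D0 D) (psrc D (r \<odot>\<^sub>p\<^bsub>D\<^esub> r)))
        (cident (D0 D) (ptgt D (r \<odot>\<^sub>p\<^bsub>D\<^esub> r)))"
    and \<nu>: "is_cell D \<nu> (s \<odot>\<^sub>p\<^bsub>D\<^esub> s) s (cident (D0 D) (psrc D (s \<odot>\<^sub>p\<^bsub>D\<^esub> s)))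
        (cident (D0 D) (ptgt D (s \<odot>\<^sub>p\<^bsub>D\<^esub> s)))"
    and \<pi>: "is_cell D \<pi> (t \<odot>\<^sub>p\<^bsub>D\<^esub> t) t (cident (D0 D) (psrc D (t \<odot>\<^sub>p\<^bsub>D\<^esub> t)))
        (cident (D0 D) (ptgt D (t \<odot>\<^sub>p\<^bsub>D\<^esub> t)))"
    and \<eta>: "is_cell D \<eta> (pid D x) r (cident (D0 D) (psrc D (pid D x)))
        (cident (D0 D) (ptgt D (pid D x)))"
    and \<theta>: "is_cell D \<theta> (pid D y) s (cident (D0 D) (psrc D (pid D y)))
        (cident (D0 D) (ptgt D (pid D y)))"
    and \<zeta>: "is_cell D \<zeta> (pid D z) t (cident (D0 D) (psrc D (pid D z)))
        (cident (D0 D) (ptgt D (pid D z)))"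
    and mult: "(\<phi> \<odot>\<^bsub>D\<^esub> \<phi>) \<cdot>\<^bsub>D1 D\<^esub> \<nu> = \<mu> \<cdot>\<^bsub>D1 D\<^esub> \<phi>"
      "(\<psi> \<odot>\<^bsub>D\<^esub> \<psi>) \<cdot>\<^bsub>D1 D\<^esub> \<pi> = \<nu> \<cdot>\<^bsub>D1 D\<^esub> \<psi>"
    and unit: "cid D f \<cdot>\<^bsub>D1 D\<^esub> \<theta> = \<eta> \<cdot>\<^bsub>D1 D\<^esub> \<phi>"
      "cid D g \<cdot>\<^bsub>D1 D\<^esub> \<zeta> = \<theta> \<cdot>\<^bsub>D1 D\<^esub> \<psi>"
    using assms unfolding X Y Z P Q by (auto simp: globular_def)
  have "((\<phi> \<cdot>\<^bsub>D1 D\<^esub> \<psi>) \<odot>\<^bsub>D\<^esub> (\<phi> \<cdot>\<^bsub>D1 D\<^esub> \<psi>)) \<cdot>\<^bsub>D1 D\<^esub> \<pi>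
      = (\<phi> \<odot>\<^bsub>D\<^esub> \<phi>) \<cdot>\<^bsub>D1 D\<^esub> ((\<psi> \<odot>\<^bsub>D\<^esub> \<psi>) \<cdot>\<^bsub>D1 D\<^esub> \<pi>)"
    unfolding interchange[OF \<phi> \<psi> \<phi> \<psi>]
    by (rule cell_assoc[OF cell_ext[OF \<phi> \<phi>] cell_ext[OF \<psi> \<psi>] \<pi>])
  also have "\<dots> = (\<phi> \<odot>\<^bsub>D\<^esub> \<phi>) \<cdot>\<^bsub>D1 D\<^esub> \<nu> \<cdot>\<^bsub>D1 D\<^esub> \<psi>"
    unfolding mult(2) by (rule cell_assoc[OF cell_ext[OF \<phi> \<phi>] \<nu> \<psi>, symmetric])
  also have "\<dots> = \<mu> \<cdot>\<^bsub>D1 D\<^esub> (\<phi> \<cdot>\<^bsub>D1 D\<^esub> \<psi>)"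
    unfolding mult(1) by (rule cell_assoc[OF \<mu> \<phi> \<psi>])
  finally have m: "((\<phi> \<cdot>\<^bsub>D1 D\<^esub> \<psi>) \<odot>\<^bsub>D\<^esub> (\<phi> \<cdot>\<^bsub>D1 D\<^esub> \<psi>)) \<cdot>\<^bsub>D1 D\<^esub> \<pi>
      = \<mu> \<cdot>\<^bsub>D1 D\<^esub> (\<phi> \<cdot>\<^bsub>D1 D\<^esub> \<psi>)" .
  have cf: "is_cell D (cid D f) (pid D x) (pid D y) f f"
    and cg: "is_cell D (cid D g) (pid D y) (pid D z) g g"
    using cid_cell[OF f(1)] cid_cell[OF g(1)] f g by auto
  \<comment> \<open>External identities form a functor, so the identity cell of the composite arrow
    splits and the unit squares can be pasted like the multiplication squares.\<close>
  have "cid D (f \<cdot>\<^bsub>D0 D\<^esub> g) \<cdot>\<^bsub>D1 D\<^esub> \<zeta> = cid D f \<cdot>\<^bsub>D1 D\<^esub> (cid D g \<cdot>\<^bsub>D1 D\<^esub> \<zeta>)"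
    using cell_assoc[OF cf cg \<zeta>] f g by (simp add: idf.map_comp)
  also have "\<dots> = cid D f \<cdot>\<^bsub>D1 D\<^esub> \<theta> \<cdot>\<^bsub>D1 D\<^esub> \<psi>"
    unfolding unit(2) by (rule cell_assoc[OF cf \<theta> \<psi>, symmetric])
  also have "\<dots> = \<eta> \<cdot>\<^bsub>D1 D\<^esub> (\<phi> \<cdot>\<^bsub>D1 D\<^esub> \<psi>)"
    unfolding unit(1) by (rule cell_assoc[OF \<eta> \<phi> \<psi>])
  finally have u: "cid D (f \<cdot>\<^bsub>D0 D\<^esub> g) \<cdot>\<^bsub>D1 D\<^esub> \<zeta>
      = \<eta> \<cdot>\<^bsub>D1 D\<^esub> (\<phi> \<cdot>\<^bsub>D1 D\<^esub> \<psi>)" .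
  have "category_object D (x, r, \<mu>, \<eta>)" "category_object D (z, t, \<pi>, \<zeta>)"
    using assms internal_functor_dom internal_functor_cod unfolding X Z by blast+
  then show ?thesis
    unfolding X Z P Q internal_functor.simps comp_functor.simps
    using m u cell_comp[OF \<phi> \<psi>] f g by (simp only: C0.comp_arr C0.dom_comp C0.cod_comp simp_thms)
qed

text \<open>With both functors and the total cell equal to identities, the two transformation
  equations are the multiplication law of the identity functor.\<close>

lemma internal_transf_ident:
  assumes "category_object D X"
  shows "internal_transf D X X (ident_functor D X) (ident_functor D X)
    (cident (D1 D) (fst (snd X)))"
proof (cases X)
  case (fields x r \<mu> \<eta>)
  then show ?thesis using internal_functor_ident[OF assms] by auto
qed

lemma internal_transf_comp:
  assumes \<alpha>: "internal_transf D X Y P Q \<alpha>" and \<beta>: "internal_transf D Y Z P' Q' \<beta>"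
  shows "internal_transf D X Z (comp_functor D P P') (comp_functor D Q Q') (\<alpha> \<cdot>\<^bsub>D1 D\<^esub> \<beta>)"
proof -
  obtain x r \<mu> \<eta> where X: "X = (x, r, \<mu>, \<eta>)" by (cases X)
  obtain y s \<nu> \<theta> where Y: "Y = (y, s, \<nu>, \<theta>)" by (cases Y)
  obtain z t \<pi> \<zeta> where Z: "Z = (z, t, \<pi>, \<zeta>)" by (cases Z)
  obtain f \<phi> g \<psi> where P: "P = (f, \<phi>)" and Q: "Q = (g, \<psi>)" by (cases P; cases Q)
  obtain f' \<phi>' g' \<psi>' where P': "P' = (f', \<phi>')" and Q': "Q' = (g', \<psi>')"
    by (cases P'; cases Q')
  have a: "is_cell D \<alpha> r s f g" and b: "is_cell D \<beta> s t f' g'"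
    and \<phi>: "is_cell D \<phi> r s f f" and \<psi>: "is_cell D \<psi> r s g g"
    and \<phi>': "is_cell D \<phi>' s t f' f'" and \<psi>': "is_cell D \<psi>' s t g' g'"
    and \<mu>: "is_cell D \<mu> (r \<odot>\<^sub>p\<^bsub>D\<^esub> r) r (cident (D0 D) (psrc D (r \<odot>\<^sub>p\<^bsub>D\<^esub> r)))
        (cident (D0 D) (ptgt D (r \<odot>\<^sub>p\<^bsub>D\<^esub> r)))"
    and \<nu>: "is_cell D \<nu> (s \<odot>\<^sub>p\<^bsub>D\<^esub> s) s (cident (D0 D) (psrc D (s \<odot>\<^sub>p\<^bsub>D\<^esub> s)))
        (cident (D0 D) (ptgt D (s \<odot>\<^sub>p\<^bsub>D\<^esub> s)))"
    and \<pi>: "is_cell D \<pi> (t \<odot>\<^sub>p\<^bsub>D\<^esub> t) t (cident (D0 D) (psrc D (t \<odot>\<^sub>p\<^bsub>D\<^esub> t)))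
        (cident (D0 D) (ptgt D (t \<odot>\<^sub>p\<^bsub>D\<^esub> t)))"
    and right: "(\<alpha> \<odot>\<^bsub>D\<^esub> \<psi>) \<cdot>\<^bsub>D1 D\<^esub> \<nu> = \<mu> \<cdot>\<^bsub>D1 D\<^esub> \<alpha>"
      "(\<beta> \<odot>\<^bsub>D\<^esub> \<psi>') \<cdot>\<^bsub>D1 D\<^esub> \<pi> = \<nu> \<cdot>\<^bsub>D1 D\<^esub> \<beta>"
    and left: "(\<phi> \<odot>\<^bsub>D\<^esub> \<alpha>) \<cdot>\<^bsub>D1 D\<^esub> \<nu> = \<mu> \<cdot>\<^bsub>D1 D\<^esub> \<alpha>"
      "(\<phi>' \<odot>\<^bsub>D\<^esub> \<beta>) \<cdot>\<^bsub>D1 D\<^esub> \<pi> = \<nu> \<cdot>\<^bsub>D1 D\<^esub> \<beta>"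
    using assms unfolding X Y Z P Q P' Q' by (auto simp: globular_def)
  \<comment> \<open>Both transformation equations have the same shape, so one pasting argument
    serves twice: \<gamma>, \<delta> become \<alpha>, \<psi> for one equation and \<phi>, \<alpha>
    for the other.\<close>
  have paste: "((\<gamma> \<cdot>\<^bsub>D1 D\<^esub> \<gamma>') \<odot>\<^bsub>D\<^esub> (\<delta> \<cdot>\<^bsub>D1 D\<^esub> \<delta>')) \<cdot>\<^bsub>D1 D\<^esub> \<pi>
      = \<mu> \<cdot>\<^bsub>D1 D\<^esub> (\<alpha> \<cdot>\<^bsub>D1 D\<^esub> \<beta>)"
    if c: "is_cell D \<gamma> r s h i" "is_cell D \<gamma>' s t h' i'"
      "is_cell D \<delta> r s i j" "is_cell D \<delta>' s t i' j'"
      and e: "(\<gamma> \<odot>\<^bsub>D\<^esub> \<delta>) \<cdot>\<^bsub>D1 D\<^esub> \<nu> = \<mu> \<cdot>\<^bsub>D1 D\<^esub> \<alpha>"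
      "(\<gamma>' \<odot>\<^bsub>D\<^esub> \<delta>') \<cdot>\<^bsub>D1 D\<^esub> \<pi> = \<nu> \<cdot>\<^bsub>D1 D\<^esub> \<beta>"
    for \<gamma> \<gamma>' \<delta> \<delta>' h i j h' i' j'
  proof -
    have "((\<gamma> \<cdot>\<^bsub>D1 D\<^esub> \<gamma>') \<odot>\<^bsub>D\<^esub> (\<delta> \<cdot>\<^bsub>D1 D\<^esub> \<delta>')) \<cdot>\<^bsub>D1 D\<^esub> \<pi>
        = (\<gamma> \<odot>\<^bsub>D\<^esub> \<delta>) \<cdot>\<^bsub>D1 D\<^esub> ((\<gamma>' \<odot>\<^bsub>D\<^esub> \<delta>') \<cdot>\<^bsub>D1 D\<^esub> \<pi>)"
      unfolding interchange[OF c]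
      by (rule cell_assoc[OF cell_ext[OF c(1,3)] cell_ext[OF c(2,4)] \<pi>])
    also have "\<dots> = (\<gamma> \<odot>\<^bsub>D\<^esub> \<delta>) \<cdot>\<^bsub>D1 D\<^esub> \<nu> \<cdot>\<^bsub>D1 D\<^esub> \<beta>"
      unfolding e(2) by (rule cell_assoc[OF cell_ext[OF c(1,3)] \<nu> b, symmetric])
    also have "\<dots> = \<mu> \<cdot>\<^bsub>D1 D\<^esub> (\<alpha> \<cdot>\<^bsub>D1 D\<^esub> \<beta>)"
      unfolding e(1) by (rule cell_assoc[OF \<mu> a b])
    finally show ?thesis .
  qed
  have F: "internal_functor D X Z (comp_functor D P P')"
    "internal_functor D X Z (comp_functor D Q Q')"
    using assms internal_transf_src internal_transf_tgt internal_functor_comp by metis+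
  show ?thesis
    using F paste[OF a b \<psi> \<psi>' right] paste[OF \<phi> \<phi>' a b left] cell_comp[OF a b]
    unfolding X Z P Q P' Q' internal_transf.simps comp_functor.simps by simp
qed

lemma ident_functor_comp:
  assumes "internal_functor D X Y P"
  shows "comp_functor D (ident_functor D X) P = P"
  using assms C0.ident_comp[of "fst P"]
  by (cases X; cases Y; cases P) (auto simp: cell_ident_comp)

lemma comp_ident_functor:
  assumes "internal_functor D X Y P"
  shows "comp_functor D P (ident_functor D Y) = P"
  using assms C0.comp_ident[of "fst P"]
  by (cases X; cases Y; cases P) (auto simp: cell_comp_ident)

lemma comp_functor_assoc:
  assumes "internal_functor D X Y P" "internal_functor D Y Z Q" "internal_functor D Z W R"
  shows "comp_functor D (comp_functor D P Q) R = comp_functor D P (comp_functor D Q R)"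
  using assms
  by (cases X; cases Y; cases Z; cases W; cases P; cases Q; cases R)
    (auto simp: C0.comp_assoc cell_assoc)

declare category_object.simps [simp del] internal_functor.simps [simp del]
  internal_transf.simps [simp del] ident_functor.simps [simp del] comp_functor.simps [simp del]

text \<open>Each category axiom is one of the preceding lemmas. With the defining equations out of
  the simpset the predicates stay folded, and the introduction rules can match them.\<close>

lemma category_functor_cat: "category (functor_cat D)"
  by unfold_locales
    (auto simp: functor_cat_def
      intro: internal_functor_dom internal_functor_cod internal_functor_ident
        internal_functor_comp ident_functor_comp comp_ident_functor comp_functor_assoc)

lemma category_transf_cat: "category (transf_cat D)"
proof unfold_locales
  note [simp] = transf_cat_def
  \<comment> \<open>An arrow carries a source functor, a target functor and a total cell, so
    associativity is checked in these three components.\<close>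
  show "a \<cdot>\<^bsub>transf_cat D\<^esub> b \<cdot>\<^bsub>transf_cat D\<^esub> c = a \<cdot>\<^bsub>transf_cat D\<^esub> (b \<cdot>\<^bsub>transf_cat D\<^esub> c)"
    if "a \<in> carr (transf_cat D)" "b \<in> carr (transf_cat D)" "c \<in> carr (transf_cat D)"
      "ccod (transf_cat D) a = cdom (transf_cat D) b" "ccod (transf_cat D) b = cdom (transf_cat D) c"
    for a b c
    using that
    by (auto intro: comp_functor_assoc[OF internal_transf_src internal_transf_src internal_transf_src]
        comp_functor_assoc[OF internal_transf_tgt internal_transf_tgt internal_transf_tgt]
        cell_assoc[OF internal_transf_cell internal_transf_cell internal_transf_cell])
qed (auto simp: transf_cat_def
      intro: internal_functor_dom[OF internal_transf_src] internal_functor_cod[OF internal_transf_src]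
        internal_transf_ident internal_transf_comp
        ident_functor_comp[OF internal_transf_src] ident_functor_comp[OF internal_transf_tgt]
        comp_ident_functor[OF internal_transf_src] comp_ident_functor[OF internal_transf_tgt]
        cell_ident_comp[OF internal_transf_cell, simplified]
        cell_comp_ident[OF internal_transf_cell, simplified])

declare category_object.simps [simp] internal_functor.simps [simp]
  internal_transf.simps [simp] ident_functor.simps [simp] comp_functor.simps [simp]

end

section \<open>Strict external unit laws, on proarrows and on cells\<close>

context strict_double_category
begin

lemma pid_ext_pid:
  assumes "x \<in> cobj (D0 D)"
  shows "pid D x \<odot>\<^sub>p\<^bsub>D\<^esub> pid D x = pid D x"
  using strict_lunit[OF idf.map_obj[OF assms]] assms by (simp add: psrc_pid)

text \<open>Strictness is postulated for proarrows and coherence cells only. The law for cells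
  follows from naturality of the left unitor, whose components are now identities.\<close>

lemma cid_ext:
  assumes "is_cell D \<alpha> m n f g"
  shows "cid D f \<odot>\<^bsub>D\<^esub> \<alpha> = \<alpha>"
proof -
  have a: "\<alpha> \<in> carr (D1 D)" using assms by (simp add: is_cell_def)
  have m: "m \<in> cobj (D1 D)" "n \<in> cobj (D1 D)" using cell_obj[OF assms] .
  have f: "f \<in> carr (D0 D)" "cdom (D0 D) f = psrc D m" "ccod (D0 D) f = psrc D n"
    using assms src.map_arr src.map_dom src.map_cod by (auto simp: is_cell_def)
  \<comment> \<open>The strict unit laws for \<open>m\<close> and \<open>n\<close> reduce the
    boundary to that of \<alpha>, so the identity unitor at \<open>n\<close> can be
    absorbed.\<close>
  have "is_cell D (cid D f \<odot>\<^bsub>D\<^esub> \<alpha>) m n f g"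
    using cell_ext[OF cid_cell[OF f(1)] assms] f strict_lunit m by simp
  from cell_comp_ident[OF this] cell_ident_comp[OF assms] lunit_natural[OF a] assms m strict_lunit
  show ?thesis by (simp add: is_cell_def)
qed

lemma ext_cid:
  assumes "is_cell D \<alpha> m n f g"
  shows "\<alpha> \<odot>\<^bsub>D\<^esub> cid D g = \<alpha>"
proof -
  have a: "\<alpha> \<in> carr (D1 D)" using assms by (simp add: is_cell_def)
  have m: "m \<in> cobj (D1 D)" "n \<in> cobj (D1 D)" using cell_obj[OF assms] .
  have g: "g \<in> carr (D0 D)" "cdom (D0 D) g = ptgt D m" "ccod (D0 D) g = ptgt D n"
    using assms tgt.map_arr tgt.map_dom tgt.map_cod by (auto simp: is_cell_def)
  have "is_cell D (\<alpha> \<odot>\<^bsub>D\<^esub> cid D g) m n f g"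
    using cell_ext[OF assms cid_cell[OF g(1)]] g strict_runit m by simp
  from cell_comp_ident[OF this] cell_ident_comp[OF assms] runit_natural[OF a] assms m strict_runit
  show ?thesis by (simp add: is_cell_def)
qed

end

section \<open>Images of objects, arrows and cells under a lax double functor with strict
  domain\<close>

locale strict_lax_double_functor =
  lax_double_functor D E F + D: strict_double_category D
  for D :: "('o, 'a, 'p, 'c) double_cat" and E :: "('o2, 'a2, 'p2, 'c2) double_cat"
    and F :: "('o, 'a, 'p, 'c, 'o2, 'a2, 'p2, 'c2) lax_fun"
begin

sublocale F0: cat_functor "D0 D" "D0 E" "Fobj F" "Farr F" by (rule functor0)
sublocale F1: cat_functor "D1 D" "D1 E" "Fpro F" "Fcell F" by (rule functor1)

lemma F_cell:
  assumes "is_cell D \<alpha> m n f g"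
  shows "is_cell E (Fcell F \<alpha>) (Fpro F m) (Fpro F n) (Farr F f) (Farr F g)"
  using assms F1.map_arr F1.map_dom F1.map_cod F_csrc F_ctgt by (auto simp: is_cell_def)

text \<open>Each coherence axiom of \<open>F\<close>, taken at \<open>pid D x\<close>, ends with
  \<open>F\<close> applied to a coherence cell of \<open>D\<close>. That cell is an identity by
  strictness and cancels, while the coherence cells of \<open>E\<close> remain as the category
  object axioms require.\<close>

lemma category_object_image:
  assumes x: "x \<in> cobj (D0 D)"
  shows "category_object E (image_catob D F x)"
proof -
  define i where "i = pid D x"
  have i: "i \<in> cobj (D1 D)" and ends: "psrc D i = x" "ptgt D i = x" and ii: "i \<odot>\<^sub>p\<^bsub>D\<^esub> i = i"
    using x D.idf.map_obj D.psrc_pid D.ptgt_pid D.pid_ext_pid by (auto simp: i_def)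
  have pair: "(i, i) \<in> cobj (composable_pairs D)"
    using i ends by (simp add: composable_pairs_def)
  define r \<mu> \<eta> where "r = Fpro F i" and "\<mu> = laxator F i i" and "\<eta> = unitor F x"
  have r: "r \<in> cobj (D1 E)" "psrc E r = Fobj F x" "ptgt E r = Fobj F x"
    using F1.map_obj[OF i] F_psrc[OF i] F_ptgt[OF i] ends by (auto simp: r_def)
  \<comment> \<open>The ends of the composite are needed because \<open>globular\<close> takes its
    frame from the domain proarrow.\<close>
  have rr: "psrc E (r \<odot>\<^sub>p\<^bsub>E\<^esub> r) = Fobj F x" "ptgt E (r \<odot>\<^sub>p\<^bsub>E\<^esub> r) = Fobj F x"
    using E.psrc_ext E.ptgt_ext r by (auto simp: composable_pairs_def)
  let ?I = "cident (D0 E) (Fobj F x)"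
  have I: "?I \<cdot>\<^bsub>D0 E\<^esub> ?I = ?I"
    using E.C0.ident_comp[of ?I] F0.map_obj[OF x] E.C0.ident_arr E.C0.dom_ident by simp
  have \<mu>: "globular E \<mu> (r \<odot>\<^sub>p\<^bsub>E\<^esub> r) r"
    using laxator_cell[OF pair] ii by (simp add: r_def \<mu>_def)
  then have \<mu>': "is_cell E \<mu> (r \<odot>\<^sub>p\<^bsub>E\<^esub> r) r ?I ?I"
    using rr by (simp add: globular_def)
  have \<eta>: "globular E \<eta> (pid E (Fobj F x)) r"
    using unitor_cell[OF x] by (simp add: r_def \<eta>_def i_def)
  then have \<eta>': "is_cell E \<eta> (pid E (Fobj F x)) r ?I ?I"
    using E.psrc_pid E.ptgt_pid F0.map_obj[OF x] by (simp add: globular_def)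
  have ident: "is_cell E (cident (D1 E) r) r r ?I ?I"
    using E.ident_cell[OF r(1)] r by simp
  have Fi: "Fcell F (cident (D1 D) i) = cident (D1 E) r"
    using F1.map_ident[OF i] by (simp add: r_def)
  have "(\<mu> \<odot>\<^bsub>E\<^esub> cident (D1 E) r) \<cdot>\<^bsub>D1 E\<^esub> \<mu>
      = lassoc E r r r \<cdot>\<^bsub>D1 E\<^esub> (cident (D1 E) r \<odot>\<^bsub>E\<^esub> \<mu>) \<cdot>\<^bsub>D1 E\<^esub> \<mu>"
    \<comment> \<open>\<open>Fi\<close> turns the image of the associator of \<open>D\<close> into
      an identity cell on \<open>r\<close>, and \<open>E.cell_comp_ident\<close> removes it.\<close>
    using laxator_assoc[OF pair pair] D.strict_assoc[OF pair pair] ii Fi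
      E.cell_comp_ident[OF E.cell_comp[OF E.cell_ext[OF \<mu>' ident] \<mu>']]
    by (simp add: r_def \<mu>_def)
  moreover have "(\<eta> \<odot>\<^bsub>E\<^esub> cident (D1 E) r) \<cdot>\<^bsub>D1 E\<^esub> \<mu> = lunit E r"
    using unitor_left[OF i] D.strict_lunit[OF i] ends Fi
      E.cell_comp_ident[OF E.cell_comp[OF E.cell_ext[OF \<eta>' ident] \<mu>']]
    by (simp add: r_def \<mu>_def \<eta>_def i_def)
  moreover have "(cident (D1 E) r \<odot>\<^bsub>E\<^esub> \<eta>) \<cdot>\<^bsub>D1 E\<^esub> \<mu> = runit E r"
    using unitor_right[OF i] D.strict_runit[OF i] ends Fi
      E.cell_comp_ident[OF E.cell_comp[OF E.cell_ext[OF ident \<eta>'] \<mu>']]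
    by (simp add: r_def \<mu>_def \<eta>_def i_def)
  ultimately have "category_object E (Fobj F x, r, \<mu>, \<eta>)"
    using F0.map_obj[OF x] r \<mu> \<eta> by simp
  then show ?thesis by (simp add: image_catob_def r_def \<mu>_def \<eta>_def i_def)
qed

text \<open>Naming the boundary proarrows puts naturality of the laxator in a form that takes typed
  cells such as \<open>D.cid_cell\<close> directly.\<close>

lemma F_cell_laxator:
  assumes "is_cell D \<alpha> m n f g" "is_cell D \<beta> k l g h"
  shows "(Fcell F \<alpha> \<odot>\<^bsub>E\<^esub> Fcell F \<beta>) \<cdot>\<^bsub>D1 E\<^esub> laxator F n l
    = laxator F m k \<cdot>\<^bsub>D1 E\<^esub> Fcell F (\<alpha> \<odot>\<^bsub>D\<^esub> \<beta>)"
  using laxator_natural[of \<alpha> \<beta>] assms by (auto simp: is_cell_def composable_pairs_def)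

text \<open>The multiplication law is laxator naturality at the pair of \<open>cid D f\<close> with
  itself, whose external composite is again \<open>cid D f\<close>; the unit law is
  \<open>unitor_natural\<close>.\<close>

lemma internal_functor_image:
  assumes f: "f \<in> carr (D0 D)"
  shows "internal_functor E (image_catob D F (cdom (D0 D) f)) (image_catob D F (ccod (D0 D) f))
    (image_functor D F f)"
  using category_object_image[OF D.C0.dom_obj[OF f]] category_object_image[OF D.C0.cod_obj[OF f]]
    F0.map_arr[OF f] F0.map_dom[OF f] F0.map_cod[OF f] F_cell[OF D.cid_cell[OF f]]
    F_cell_laxator[OF D.cid_cell[OF f] D.cid_cell[OF f]] D.cid_ext[OF D.cid_cell[OF f]]
    unitor_natural[OF f]
  unfolding image_catob_def image_functor_def internal_functor.simps by simp

text \<open>The two equations are laxator naturality at (\<alpha>, \<open>cid D g\<close>) and at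
  (\<open>cid D f\<close>, \<alpha>). Both external composites collapse to \<alpha>, so both
  right-hand sides agree.\<close>

lemma internal_transf_image:
  assumes x: "x \<in> cobj (D0 D)" and y: "y \<in> cobj (D0 D)"
    and \<alpha>: "is_cell D \<alpha> (pid D x) (pid D y) f g"
  shows "internal_transf E (image_catob D F x) (image_catob D F y)
    (image_functor D F f) (image_functor D F g) (Fcell F \<alpha>)"
proof -
  \<comment> \<open>The ends of \<open>f\<close> are the external sources of the boundary of
    \<alpha>, and \<open>psrc\<close> undoes \<open>pid\<close>; likewise for \<open>g\<close> with
    \<open>ptgt\<close>.\<close>
  have f: "f \<in> carr (D0 D)" "cdom (D0 D) f = x" "ccod (D0 D) f = y"
    using \<alpha> x y D.src.map_arr D.src.map_dom[of \<alpha>] D.src.map_cod[of \<alpha>]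
    by (auto simp: is_cell_def D.psrc_pid)
  have g: "g \<in> carr (D0 D)" "cdom (D0 D) g = x" "ccod (D0 D) g = y"
    using \<alpha> x y D.tgt.map_arr D.tgt.map_dom[of \<alpha>] D.tgt.map_cod[of \<alpha>]
    by (auto simp: is_cell_def D.ptgt_pid)
  show ?thesis
    using internal_functor_image[OF f(1)] internal_functor_image[OF g(1)] f g F_cell[OF \<alpha>]
      F_cell_laxator[OF \<alpha> D.cid_cell[OF g(1)]] F_cell_laxator[OF D.cid_cell[OF f(1)] \<alpha>]
      D.cid_ext[OF \<alpha>] D.ext_cid[OF \<alpha>]
    unfolding image_catob_def image_functor_def internal_transf.simps by simp
qed

lemma image_functor_ident:
  assumes "x \<in> cobj (D0 D)"
  shows "image_functor D F (cident (D0 D) x) = ident_functor E (image_catob D F x)"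
  using assms
  by (simp add: image_functor_def image_catob_def F0.map_ident D.idf.map_ident
      F1.map_ident[OF D.idf.map_obj])

lemma image_functor_comp:
  assumes "f \<in> carr (D0 D)" "g \<in> carr (D0 D)" "ccod (D0 D) f = cdom (D0 D) g"
  shows "image_functor D F (f \<cdot>\<^bsub>D0 D\<^esub> g)
    = comp_functor E (image_functor D F f) (image_functor D F g)"
  using assms
  by (simp add: image_functor_def F0.map_comp D.idf.map_comp F1.map_comp D.idf.map_arr
      D.idf.map_dom D.idf.map_cod)

section \<open>Functoriality of the assignments\<close>

lemma cat_functor_image:
  "cat_functor (D0 D) (functor_cat E) (image_catob D F)
    (\<lambda>f. (image_catob D F (cdom (D0 D) f), image_catob D F (ccod (D0 D) f),
          image_functor D F f))"
  by (intro cat_functor.intro D.cat0 E.category_functor_cat cat_functor_axioms.intro)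
    (auto simp: functor_cat_def category_object_image internal_functor_image image_functor_ident
      image_functor_comp D.C0.dom_ident D.C0.cod_ident D.C0.dom_comp D.C0.cod_comp)

text \<open>The cells of part (iii) are the arrows of the full subcategory of \<open>D1 D\<close> on
  the external identities. As \<open>psrc\<close> inverts \<open>pid\<close> there, it recovers the
  object from its identity proarrow.\<close>

lemma cat_functor_image_transf:
  "cat_functor (full_subcat (D1 D) (pid D ` cobj (D0 D))) (transf_cat E)
    (\<lambda>m. image_catob D F (psrc D m))
    (\<lambda>\<alpha>. (image_catob D F (psrc D (cdom (D1 D) \<alpha>)),
          image_catob D F (psrc D (ccod (D1 D) \<alpha>)),
          image_functor D F (csrc D \<alpha>), image_functor D F (ctgt D \<alpha>), Fcell F \<alpha>))"
  (is "cat_functor ?S _ ?O ?A")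
proof -
  have transf: "internal_transf E (?O (cdom (D1 D) \<alpha>)) (?O (ccod (D1 D) \<alpha>))
      (image_functor D F (csrc D \<alpha>)) (image_functor D F (ctgt D \<alpha>)) (Fcell F \<alpha>)"
    if \<alpha>: "\<alpha> \<in> carr ?S" for \<alpha>
  proof -
    from \<alpha> obtain x y where "\<alpha> \<in> carr (D1 D)" "x \<in> cobj (D0 D)" "y \<in> cobj (D0 D)"
      "cdom (D1 D) \<alpha> = pid D x" "ccod (D1 D) \<alpha> = pid D y"
      by (auto simp: full_subcat_def)
    then show ?thesis
      using internal_transf_image[of x y \<alpha> "csrc D \<alpha>" "ctgt D \<alpha>"]
      by (simp add: is_cell_def D.psrc_pid)
  qed
  \<comment> \<open>The cell component is \<open>F\<close> of the identity cell on
    \<open>pid D x\<close>, hence the identity cell on the proarrow of the image category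
    object.\<close>
  have ident: "?A (cident (D1 D) (pid D x))
      = cident (transf_cat E) (image_catob D F x)" if x: "x \<in> cobj (D0 D)" for x
    using x D.idf.map_obj[OF x]
    by (simp add: transf_cat_def D.C1.dom_ident D.C1.cod_ident D.src.map_ident D.tgt.map_ident
        D.psrc_pid D.ptgt_pid image_functor_ident F1.map_ident)
      (simp add: image_catob_def)
  \<comment> \<open>This holds for arbitrary composable cells of \<open>D1 D\<close>, by
    functoriality of \<open>F\<close>, \<open>csrc\<close> and \<open>ctgt\<close>.\<close>
  have comp: "?A (\<alpha> \<cdot>\<^bsub>D1 D\<^esub> \<beta>) = ?A \<alpha> \<cdot>\<^bsub>transf_cat E\<^esub> ?A \<beta>"
    if "\<alpha> \<in> carr (D1 D)" "\<beta> \<in> carr (D1 D)" "ccod (D1 D) \<alpha> = cdom (D1 D) \<beta>" for \<alpha> \<beta>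
    using that
    by (simp add: transf_cat_def D.C1.dom_comp D.C1.cod_comp D.src.map_comp D.tgt.map_comp
        F1.map_comp image_functor_comp D.src.map_arr D.tgt.map_arr D.src.map_dom D.src.map_cod
        D.tgt.map_dom D.tgt.map_cod)
  show ?thesis
  proof (intro cat_functor.intro category_full_subcat D.cat1 E.category_transf_cat
      cat_functor_axioms.intro)
    show "?O m \<in> cobj (transf_cat E)" if "m \<in> cobj ?S" for m
      using that category_object_image by (auto simp: full_subcat_def transf_cat_def D.psrc_pid)
    show "?A \<alpha> \<in> carr (transf_cat E)" if "\<alpha> \<in> carr ?S" for \<alpha>
      using transf[OF that] by (simp add: transf_cat_def)
    show "?A (cident ?S m) = cident (transf_cat E) (?O m)" if "m \<in> cobj ?S" for m
      using that ident by (auto simp: full_subcat_def D.psrc_pid)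
    show "?A (\<alpha> \<cdot>\<^bsub>?S\<^esub> \<beta>) = ?A \<alpha> \<cdot>\<^bsub>transf_cat E\<^esub> ?A \<beta>"
      if "\<alpha> \<in> carr ?S" "\<beta> \<in> carr ?S" "ccod ?S \<alpha> = cdom ?S \<beta>" for \<alpha> \<beta>
      using that comp[of \<alpha> \<beta>] by (simp add: full_subcat_def)
  qed (simp_all add: full_subcat_def transf_cat_def)
qed

end

theorem proposition2p10:
  fixes D :: "('o, 'a, 'p, 'c) double_cat"
    and E :: "('o2, 'a2, 'p2, 'c2) double_cat"
    and F :: "('o, 'a, 'p, 'c, 'o2, 'a2, 'p2, 'c2) lax_fun"
  assumes "strict_double_category D"
    and "double_category E"
    and "lax_double_functor D E F"
  shows
    "(\<forall>x \<in> cobj (D0 D).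
        category_object E
          (Fobj F x, Fpro F (pid D x), laxator F (pid D x) (pid D x), unitor F x)) \<and>
     (\<forall>f x y. f \<in> carr (D0 D) \<and> cdom (D0 D) f = x \<and> ccod (D0 D) f = y \<longrightarrow>
        internal_functor E (image_catob D F x) (image_catob D F y)
          (Farr F f, Fcell F (cid D f))) \<and>
     (\<forall>\<alpha> x y f g. x \<in> cobj (D0 D) \<and> y \<in> cobj (D0 D) \<and>
          is_cell D \<alpha> (pid D x) (pid D y) f g \<longrightarrow>
        internal_transf E (image_catob D F x) (image_catob D F y)
          (Farr F f, Fcell F (cid D f)) (Farr F g, Fcell F (cid D g)) (Fcell F \<alpha>)) \<and>
     cat_functor (D0 D) (functor_cat E)
       (image_catob D F)
       (\<lambda>f. (image_catob D F (cdom (D0 D) f), image_catob D F (ccod (D0 D) f),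
             image_functor D F f)) \<and>
     cat_functor (full_subcat (D1 D) (pid D ` cobj (D0 D))) (transf_cat E)
       (\<lambda>m. image_catob D F (psrc D m))
       (\<lambda>\<alpha>. (image_catob D F (psrc D (cdom (D1 D) \<alpha>)),
             image_catob D F (psrc D (ccod (D1 D) \<alpha>)),
             image_functor D F (csrc D \<alpha>), image_functor D F (ctgt D \<alpha>), Fcell F \<alpha>))"
proof -
  interpret strict_lax_double_functor D E F
    using assms by (simp add: strict_lax_double_functor_def)
  show ?thesis
    using category_object_image internal_functor_image internal_transf_image
      cat_functor_image cat_functor_image_transf
    \<comment> \<open>The statement spells out the pairs of \<open>image_functor\<close> in the
      clauses on functors and transformations and the tuple of \<open>image_catob\<close> in the
      clause on objects; unfolding aligns the lemmas with it.\<close>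
    unfolding image_functor_def by (auto simp: image_catob_def)
qed

end
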